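(* Let $n\ge2$ be even, let $\mathbb F$ be an algebraically closed field of characteristic not $2$, let $V=\mathbb F^n$ with standard basis $e_1,\dots,e_n$, and let $B$ be the nondegenerate symplectic form on $V$ with matrix $\left(\begin{smallmatrix}0&I\\-I&0\end{smallmatrix}\right)$. Put $$x_{2\ell-1}=e_\ell\ \ (1\le\ell\le n/2),\qquad x_{2\ell}=e_{\ell+n/2}+e_{\ell+n/2+1}\ \ (1\le\ell<n/2),\qquad x_n=e_n .$$ Then the linear transformations $u(x_i)\colon V\to V$, $v\mapsto B(x_i,v)x_i$ ($i=1,\dots,n$), realize the graph $\Gamma_{C;n}$, the path with vertices $1,\dots,n$ and edges $\{i,i+1\}$ for $1\le i\le n-1$. Moreover, the Lie algebra $\langle u(x_1),\dots,u(x_n)\rangle_{\mathrm{Lie}}$ they generate is $\mathfrak{sp}_n$, the Lie algebra of all linear endomorphisms of $V$ that are skew with respect to $B$.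
   Context: A nonzero element $x$ of a Lie algebra $\mathcal L$ over $\mathbb F$ is extremal if $[x,[x,\mathcal L]]\subseteq\mathbb Fx$. Elements $y_1,\dots,y_n$ of a Lie algebra realize a graph $\Gamma$ on $\{1,\dots,n\}$ if each $y_i$ is an extremal element of the Lie algebra generated by $y_1,\dots,y_n$ and, for $i\ne j$, vertices $i,j$ are adjacent if and only if $[y_i,y_j]\ne0$. The Lie bracket on endomorphisms is the commutator. *)

theory Defs
  imports "HOL-Analysis.Cartesian_Space" "HOL-Computational_Algebra.Polynomial"
    "HOL-Library.Function_Algebras"
begin

section \<open>Lie algebras, extremal elements and realizations of graphs\<close>

text \<open>The Lie algebra is given by a carrier inside an ambient vector space type.\<close>

locale lie_algebra = vector_space scale
  for scale :: "'a::field \<Rightarrow> 'b::ab_group_add \<Rightarrow> 'b" +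
  fixes L :: "'b set" and bracket :: "'b \<Rightarrow> 'b \<Rightarrow> 'b"
  assumes subspace_carrier: "subspace L"
    and bracket_closed: "\<lbrakk>x \<in> L; y \<in> L\<rbrakk> \<Longrightarrow> bracket x y \<in> L"
    and bracket_add_left:
      "\<lbrakk>x \<in> L; y \<in> L; z \<in> L\<rbrakk> \<Longrightarrow> bracket (x + y) z = bracket x z + bracket y z"
    and bracket_add_right:
      "\<lbrakk>x \<in> L; y \<in> L; z \<in> L\<rbrakk> \<Longrightarrow> bracket x (y + z) = bracket x y + bracket x z"
    and bracket_scale_left:
      "\<lbrakk>x \<in> L; y \<in> L\<rbrakk> \<Longrightarrow> bracket (scale c x) y = scale c (bracket x y)"
    and bracket_scale_right:
      "\<lbrakk>x \<in> L; y \<in> L\<rbrakk> \<Longrightarrow> bracket x (scale c y) = scale c (bracket x y)"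
    and bracket_self: "x \<in> L \<Longrightarrow> bracket x x = 0"
    and jacobi: "\<lbrakk>x \<in> L; y \<in> L; z \<in> L\<rbrakk> \<Longrightarrow>
      bracket x (bracket y z) + bracket y (bracket z x) + bracket z (bracket x y) = 0"
begin

definition lie_subalgebra :: "'b set \<Rightarrow> bool" where
  "lie_subalgebra M \<longleftrightarrow>
     M \<subseteq> L \<and> subspace M \<and> (\<forall>x\<in>M. \<forall>y\<in>M. bracket x y \<in> M)"

definition lie_generated :: "'b set \<Rightarrow> 'b set" where
  "lie_generated S = lie_subalgebra hull S"

definition extremal_in :: "'b set \<Rightarrow> 'b \<Rightarrow> bool" where
  "extremal_in M x \<longleftrightarrow>
     x \<in> M \<and> x \<noteq> 0 \<and> (\<lambda>y. bracket x (bracket x y)) ` M \<subseteq> range (\<lambda>c. scale c x)"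

text \<open>A graph on \<open>{1..n}\<close> is given by its set \<open>E\<close> of two-element edges.\<close>

definition realizes :: "nat \<Rightarrow> nat set set \<Rightarrow> (nat \<Rightarrow> 'b) \<Rightarrow> bool" where
  "realizes n E y \<longleftrightarrow>
     (\<forall>i\<in>{1..n}. y i \<in> L) \<and>
     (\<forall>i\<in>{1..n}. extremal_in (lie_generated (y ` {1..n})) (y i)) \<and>
     (\<forall>i\<in>{1..n}. \<forall>j\<in>{1..n}. i \<noteq> j \<longrightarrow> ({i, j} \<in> E \<longleftrightarrow> bracket (y i) (y j) \<noteq> 0))"

end

definition path_edges :: "nat \<Rightarrow> nat set set" where
  "path_edges n = {{i, i + 1} | i. 1 \<le> i \<and> i \<le> n - 1}"


section \<open>The Lie algebra of endomorphisms of the coordinate space\<close>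

text \<open>Addition, subtraction and zero of maps are pointwise (\<open>Function_Algebras\<close>).\<close>

definition map_scale :: "'a::field \<Rightarrow> ('a^'n \<Rightarrow> 'a^'n) \<Rightarrow> 'a^'n \<Rightarrow> 'a^'n" where
  "map_scale c f = (\<lambda>v. c *s f v)"

definition endomorphisms :: "('a::field^'n \<Rightarrow> 'a^'n) set" where
  "endomorphisms = {f. Vector_Spaces.linear (*s) (*s) f}"

definition commutator :: "('a::field^'n \<Rightarrow> 'a^'n) \<Rightarrow> ('a^'n \<Rightarrow> 'a^'n) \<Rightarrow> 'a^'n \<Rightarrow> 'a^'n" where
  "commutator f g = (f \<circ> g) - (g \<circ> f)"

lemma endomorphisms_iff:
  "f \<in> endomorphisms \<longleftrightarrow> (\<forall>v w. f (v + w) = f v + f w) \<and> (\<forall>c v. f (c *s v) = c *s f v)"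
  unfolding endomorphisms_def Vector_Spaces.linear_iff
  by (simp add: vec.vector_space_axioms)

lemma endomorphism_diff:
  assumes "f \<in> endomorphisms"
  shows "f (v - w) = f v - f w"
  using assms unfolding endomorphisms_iff by (metis add_diff_cancel diff_add_cancel)

global_interpretation gl: lie_algebra map_scale endomorphisms commutator
  defines gl_lie_subalgebra = gl.lie_subalgebra
    and gl_lie_generated = gl.lie_generated
    and gl_extremal_in = gl.extremal_in
    and gl_realizes = gl.realizes
proof -
  interpret m: vector_space map_scale
    by unfold_locales
      (auto simp: map_scale_def fun_eq_iff vec.scale_right_distrib vec.scale_left_distrib)
  show "lie_algebra map_scale endomorphisms
      (commutator :: ('a^'n \<Rightarrow> 'a^'n) \<Rightarrow> ('a^'n \<Rightarrow> 'a^'n) \<Rightarrow> 'a^'n \<Rightarrow> 'a^'n)"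
  proof (unfold_locales, goal_cases)
    case 1
    show ?case
      unfolding m.subspace_def
      by (auto simp: endomorphisms_iff map_scale_def vec.scale_right_distrib mult.commute)
  next
    case (2 f g)
    then show ?case
      unfolding endomorphisms_iff commutator_def
      by (simp add: fun_diff_def vec.scale_right_diff_distrib)
  next
    case (8 f g h)
    then show ?case
      by (simp add: commutator_def fun_eq_iff endomorphism_diff)
  qed (auto simp: endomorphisms_iff commutator_def map_scale_def fun_eq_iff
        vec.scale_right_diff_distrib)
qed


section \<open>The symplectic form\<close>

text \<open>
  Below, \<open>p\<close> is a bijection from \<open>{1..n}\<close> onto the index type of the coordinate space; it
  numbers the coordinates, so that the \<open>k\<close>-th standard basis vector is \<open>std_basis p k\<close>.
\<close>

definition std_basis :: "(nat \<Rightarrow> 'n) \<Rightarrow> nat \<Rightarrow> 'a::field^'n" where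
  "std_basis p k = axis (p k) 1"

text \<open>The entries of the block matrix with rows \<open>(0, I)\<close> and \<open>(-I, 0)\<close>, indexed from 1.\<close>

definition symp_matrix :: "nat \<Rightarrow> nat \<Rightarrow> nat \<Rightarrow> 'a::field" where
  "symp_matrix n i j =
     (if i \<le> n div 2 \<and> j = i + n div 2 then 1
      else if j \<le> n div 2 \<and> i = j + n div 2 then -1
      else 0)"

definition symp_form :: "nat \<Rightarrow> (nat \<Rightarrow> 'n) \<Rightarrow> 'a::field^'n \<Rightarrow> 'a^'n \<Rightarrow> 'a" where
  "symp_form n p v w = (\<Sum>i=1..n. \<Sum>j=1..n. v $ p i * symp_matrix n i j * w $ p j)"

definition skew_endomorphisms :: "('a::field^'n \<Rightarrow> 'a^'n \<Rightarrow> 'a) \<Rightarrow> ('a^'n \<Rightarrow> 'a^'n) set" where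
  "skew_endomorphisms B = {f \<in> endomorphisms. \<forall>v w. B (f v) w = - B v (f w)}"

definition rank_one_map :: "('a::field^'n \<Rightarrow> 'a^'n \<Rightarrow> 'a) \<Rightarrow> 'a^'n \<Rightarrow> 'a^'n \<Rightarrow> 'a^'n" where
  "rank_one_map B x = (\<lambda>v. B x v *s x)"

end

theory Submission
  imports Defs
begin

text \<open>
  Write \<open>u(a)\<close> for the rank one map of \<open>a\<close> and \<open>u(a,b)\<close> for its polarization
  \<open>v \<mapsto> B(b,v)a + B(a,v)b\<close>.  For skew \<open>f\<close> one has \<open>[f,u(z)] = u(f z, z)\<close>.  Since \<open>B(x\<^sub>i,x\<^sub>j)\<close>
  vanishes exactly when \<open>i\<close> and \<open>j\<close> are not neighbours on the path, bracketing \<open>u(x\<^sub>i,x\<^sub>j)\<close> with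
  \<open>u(x\<^sub>j\<^sub>+\<^sub>1)\<close> gives a nonzero multiple of \<open>u(x\<^sub>i,x\<^sub>j\<^sub>+\<^sub>1)\<close>, so all \<open>u(x\<^sub>i,x\<^sub>j)\<close> are generated, and
  by bilinearity all \<open>u(a,b)\<close>, as the \<open>x\<^sub>i\<close> span \<open>V\<close>.  With a symplectic basis \<open>(a\<^sub>l,b\<^sub>l)\<close>,
  every skew \<open>f\<close> satisfies \<open>2f = \<Sum>\<^sub>l u(a\<^sub>l, f b\<^sub>l) - u(b\<^sub>l, f a\<^sub>l)\<close>.
\<close>

section \<open>Generated Lie subalgebras\<close>

context lie_algebra
begin

lemma lie_subalgebra_carrier: "lie_subalgebra L"
  unfolding lie_subalgebra_def using subspace_carrier bracket_closed by blast

text \<open>The hull is the intersection of all subalgebras containing \<open>S\<close>. The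
  assumption \<open>S \<subseteq> L\<close> puts \<open>L\<close> itself into this family, which
  keeps the intersection inside the carrier.\<close>

lemma lie_subalgebra_generated:
  assumes "S \<subseteq> L"
  shows "lie_subalgebra (lie_generated S)"
proof -
  have L: "L \<in> {T. lie_subalgebra T \<and> S \<subseteq> T}"
    using lie_subalgebra_carrier assms by simp
  have "subspace (\<Inter>{T. lie_subalgebra T \<and> S \<subseteq> T})"
    by (rule subspace_Inter) (auto simp: lie_subalgebra_def)
  moreover have "\<Inter>{T. lie_subalgebra T \<and> S \<subseteq> T} \<subseteq> L"
    using L by blast
  ultimately show ?thesis
    unfolding lie_generated_def hull_def lie_subalgebra_def[of "\<Inter>_"]
    by (auto simp: lie_subalgebra_def)
qed

lemma lie_generated_superset: "S \<subseteq> lie_generated S"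
  unfolding lie_generated_def by (rule hull_subset)

lemma lie_generated_minimal: "S \<subseteq> M \<Longrightarrow> lie_subalgebra M \<Longrightarrow> lie_generated S \<subseteq> M"
  unfolding lie_generated_def by (rule hull_minimal)

end

section \<open>Rank one maps of an alternating form and their polarizations\<close>

definition polar_map :: "('a::field^'n \<Rightarrow> 'a^'n \<Rightarrow> 'a) \<Rightarrow> 'a^'n \<Rightarrow> 'a^'n \<Rightarrow> 'a^'n \<Rightarrow> 'a^'n" where
  "polar_map B a b = (\<lambda>v. B b v *s a + B a v *s b)"

lemma endomorphism_zero: "f \<in> endomorphisms \<Longrightarrow> f 0 = 0"
  using endomorphism_diff[of f 0 0] by simp

lemma endomorphism_sum: "f \<in> endomorphisms \<Longrightarrow> f (sum g A) = (\<Sum>i\<in>A. f (g i))"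
  by (induction A rule: infinite_finite_induct) (simp_all add: endomorphism_zero endomorphisms_iff)

locale alternating_form =
  fixes B :: "'a::field^'n \<Rightarrow> 'a^'n \<Rightarrow> 'a"
  assumes add_left: "B (v + v') w = B v w + B v' w"
    and add_right: "B v (w + w') = B v w + B v w'"
    and scale_left: "B (c *s v) w = c * B v w"
    and scale_right: "B v (c *s w) = c * B v w"
    and self: "B v v = 0"
begin

lemma antisym: "B w v = - B v w"
proof -
  have "B (v + w) (v + w) = B v w + B w v"
    unfolding add_left add_right by (simp add: self)
  then have "B v w + B w v = 0"
    unfolding self by (rule sym)
  then show ?thesis
    by (rule minus_unique[symmetric])
qed

lemma zero_left: "B 0 w = 0"
  using scale_left[of 0] by simp

lemma zero_right: "B v 0 = 0"
  using scale_right[of _ 0] by simp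

lemma neg_right: "B v (- w) = - B v w"
  using scale_right[of _ "-1"] by simp

lemma neg_left: "B (- v) w = - B v w"
  using scale_left[of "-1"] by simp

lemma diff_right: "B v (w - w') = B v w - B v w'"
  using add_right[of v w "- w'"] by (simp add: neg_right)

lemma skew_imp_endomorphism: "f \<in> skew_endomorphisms B \<Longrightarrow> f \<in> endomorphisms"
  by (simp add: skew_endomorphisms_def)

lemma skew_swap: "f \<in> skew_endomorphisms B \<Longrightarrow> B v (f w) = - B (f v) w"
  by (simp add: skew_endomorphisms_def)

text \<open>\<open>B (rank_one_map B z v) w\<close> is the product \<open>B z v * B z w\<close>,
  symmetric in \<open>v\<close> and \<open>w\<close>; antisymmetry of \<open>B\<close> turns this
  symmetry into skewness. The same argument works for the polarization below.\<close>

lemma rank_one_skew: "rank_one_map B z \<in> skew_endomorphisms B"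
proof -
  have "B z v * B z w = - (B z w * B v z)" for v w
    using antisym[of z v] by simp
  then show ?thesis
    unfolding skew_endomorphisms_def endomorphisms_iff rank_one_map_def
    by (simp add: add_right scale_right scale_left vec.scale_left_distrib)
qed

lemma polar_skew: "polar_map B a b \<in> skew_endomorphisms B"
proof -
  have "B (polar_map B a b v) w = - B v (polar_map B a b w)" for v w
    by (simp add: polar_map_def add_left add_right scale_left scale_right antisym[of a v]
        antisym[of b v] neg_left flip: vec.scale_minus_left)
  then show ?thesis
    unfolding skew_endomorphisms_def endomorphisms_iff
    by (simp add: polar_map_def add_right scale_right vec.scale_left_distrib
        vec.scale_right_distrib)
qed

text \<open>Moving both factors of \<open>f \<circ> g\<close> across \<open>B\<close> costs two
  signs, which cancel, and reverses the order; the commutator therefore changes sign.\<close>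

lemma skew_lie_subalgebra: "gl_lie_subalgebra (skew_endomorphisms B)"
proof -
  have "commutator f g \<in> skew_endomorphisms B"
    if "f \<in> skew_endomorphisms B" "g \<in> skew_endomorphisms B" for f g
  proof -
    have "commutator f g \<in> endomorphisms"
      using that by (intro gl.bracket_closed skew_imp_endomorphism)
    moreover have "B (commutator f g v) w = - B v (commutator f g w)" for v w
      using that add_left[of "f (g v)" "- g (f v)"]
      by (simp add: commutator_def diff_right neg_left skew_swap)
    ultimately show ?thesis
      by (simp add: skew_endomorphisms_def)
  qed
  moreover have "gl.subspace (skew_endomorphisms B)"
    unfolding gl.subspace_def skew_endomorphisms_def endomorphisms_iff
    by (auto simp: map_scale_def zero_left zero_right add_left add_right scale_left scale_right
        vec.scale_right_distrib mult.commute)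
  ultimately show ?thesis
    unfolding gl.lie_subalgebra_def using skew_imp_endomorphism by blast
qed

text \<open>The minus sign of the commutator is absorbed when \<open>f\<close> is moved across
  \<open>B\<close>: \<open>- B z (f v)\<close> equals \<open>B (f z) v\<close>.\<close>

lemma commutator_rank_one:
  "f \<in> skew_endomorphisms B \<Longrightarrow> commutator f (rank_one_map B z) = polar_map B (f z) z"
  using skew_imp_endomorphism[of f]
  by (simp add: fun_eq_iff commutator_def rank_one_map_def polar_map_def skew_swap
      endomorphisms_iff)

lemma polar_self: "polar_map B z z = map_scale 2 (rank_one_map B z)"
  by (simp add: fun_eq_iff polar_map_def map_scale_def rank_one_map_def
      flip: vec.scale_left_distrib)

lemma polar_commute: "polar_map B a b = polar_map B b a"
  by (simp add: fun_eq_iff polar_map_def add.commute)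

lemma polar_scale: "polar_map B (c *s a) b = map_scale c (polar_map B a b)"
  by (simp add: fun_eq_iff polar_map_def map_scale_def scale_left vec.scale_right_distrib
      mult.commute)

lemma polar_add: "polar_map B (a + a') b = polar_map B a b + polar_map B a' b"
  by (simp add: fun_eq_iff polar_map_def add_left vec.scale_right_distrib vec.scale_left_distrib)

lemma polar_zero: "polar_map B 0 b = 0"
  by (simp add: fun_eq_iff polar_map_def zero_left)

lemma commutator_rank_one_rank_one:
  "commutator (rank_one_map B y) (rank_one_map B z) = map_scale (B y z) (polar_map B y z)"
  by (simp add: commutator_rank_one rank_one_skew polar_scale[symmetric])
    (simp add: rank_one_map_def)

lemma commutator_rank_one_eq_0_iff:
  "commutator (rank_one_map B y) (rank_one_map B z) = 0 \<longleftrightarrow> B y z = 0"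
proof
  assume "commutator (rank_one_map B y) (rank_one_map B z) = 0"
  \<comment> \<open>Evaluation at \<open>y\<close> kills the summand with \<open>B y y\<close>, so
    the equation says that the square of \<open>B y z\<close> annihilates \<open>y\<close>.\<close>
  then have "B y z *s polar_map B y z y = 0"
    unfolding commutator_rank_one_rank_one by (auto simp: map_scale_def fun_eq_iff)
  then have "B y z = 0 \<or> y = 0"
    using antisym[of y z] by (auto simp: polar_map_def self)
  then show "B y z = 0"
    by (auto simp: zero_left)
qed (simp add: commutator_rank_one_rank_one map_scale_def fun_eq_iff)

text \<open>Write \<open>u\<close> for the rank one map of \<open>z\<close>. As
  \<open>B z z = 0\<close>, \<open>u\<close> squares to zero, so only \<open>-2 u f u\<close>
  survives in the double commutator, and \<open>u f u\<close> is \<open>B z (f z)\<close> times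
  \<open>u\<close>. This is what makes \<open>u\<close> extremal.\<close>

lemma commutator_rank_one_twice:
  assumes "f \<in> endomorphisms"
  shows "commutator (rank_one_map B z) (commutator (rank_one_map B z) f) =
    map_scale (- 2 * B z (f z)) (rank_one_map B z)"
proof -
  have *: "f (c *s v) = c *s f v" "f (v + w) = f v + f w" for c v w
    using assms by (auto simp: endomorphisms_iff)
  show ?thesis
    by (simp add: fun_eq_iff commutator_def rank_one_map_def map_scale_def * scale_right
        diff_right self vec.scale_left_diff_distrib endomorphism_zero[OF assms]
        vec_eq_iff)
qed

text \<open>Induction on \<open>j\<close> with \<open>i\<close> fixed: bracketing with the next rank
  one map moves the second argument one vertex along the path.\<close>

lemma polar_in_of_path:
  assumes M: "gl_lie_subalgebra M" and two: "(2::'a) \<noteq> 0"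
    and gen: "\<And>i. \<lbrakk>1 \<le> i; i \<le> n\<rbrakk> \<Longrightarrow> rank_one_map B (x i) \<in> M"
    and adj: "\<And>i. \<lbrakk>1 \<le> i; i < n\<rbrakk> \<Longrightarrow> B (x i) (x (Suc i)) \<noteq> 0"
    and far: "\<And>i j. \<lbrakk>1 \<le> i; Suc i < j; j \<le> n\<rbrakk> \<Longrightarrow> B (x i) (x j) = 0"
    and "1 \<le> i" "i \<le> j" "j \<le> n"
  shows "polar_map B (x i) (x j) \<in> M"
  using \<open>i \<le> j\<close> \<open>j \<le> n\<close>
proof (induction j rule: dec_induct)
  case base
  have "gl.subspace M" using M by (simp add: gl.lie_subalgebra_def)
  then show ?case
    unfolding polar_self using gen \<open>1 \<le> i\<close> base by (intro gl.subspace_scale) auto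
next
  case (step j)
  define c where "c = B (x j) (x (Suc j))"
  \<comment> \<open>The factor picked up in the bracket. For \<open>i = j\<close> both summands of
    the polarization contribute \<open>c\<close>; for \<open>i < j\<close> the hypothesis
    \<open>far\<close> removes one of them. Characteristic other than 2 makes \<open>d\<close>
    invertible.\<close>
  define d where "d = (if i = j then 2 * c else c)"
  have "c \<noteq> 0"
    unfolding c_def using adj step \<open>1 \<le> i\<close> by simp
  then have d: "d \<noteq> 0"
    using two by (simp add: d_def)
  have "polar_map B (x i) (x j) (x (Suc j)) = d *s x i"
  proof (cases "i = j")
    case True
    then show ?thesis
      by (simp add: polar_map_def d_def c_def flip: vec.scale_left_distrib)
  next
    case False
    then have "B (x i) (x (Suc j)) = 0"
      using far step \<open>1 \<le> i\<close> by simp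
    then show ?thesis
      using False by (simp add: polar_map_def d_def c_def)
  qed
  moreover have "commutator (polar_map B (x i) (x j)) (rank_one_map B (x (Suc j))) \<in> M"
    using M step gen by (auto simp: gl.lie_subalgebra_def)
  ultimately have "map_scale d (polar_map B (x i) (x (Suc j))) \<in> M"
    by (simp add: commutator_rank_one polar_skew polar_scale)
  then have "map_scale (inverse d) (map_scale d (polar_map B (x i) (x (Suc j)))) \<in> M"
    using M unfolding gl.lie_subalgebra_def by (blast intro: gl.subspace_scale)
  then show ?case
    using d by (simp add: map_scale_def)
qed

text \<open>Linearity extends one argument at a time: first the left one against a fixed element of
  \<open>S\<close>, then, by symmetry of the polarization, the other.\<close>

lemma polar_in_of_spanning:
  assumes M: "gl_lie_subalgebra M" and S: "vec.span S = UNIV"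
    and polar: "\<And>a b. \<lbrakk>a \<in> S; b \<in> S\<rbrakk> \<Longrightarrow> polar_map B a b \<in> M"
  shows "polar_map B a b \<in> M"
proof -
  have sub: "gl.subspace M"
    using M by (simp add: gl.lie_subalgebra_def)
  have vsub: "vec.subspace {a. polar_map B a b \<in> M}" for b
    unfolding vec.subspace_def using sub
    by (simp add: polar_zero polar_add polar_scale gl.subspace_0 gl.subspace_add gl.subspace_scale)
  have left: "polar_map B a b \<in> M" if "b \<in> S" for a b
  proof -
    have "vec.span S \<subseteq> {a. polar_map B a b \<in> M}"
      using polar that by (intro vec.span_minimal vsub) auto
    then show ?thesis using S by auto
  qed
  have "vec.span S \<subseteq> {b. polar_map B b a \<in> M}"
    using left by (intro vec.span_minimal vsub) (auto simp: polar_commute[of _ a])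
  then show ?thesis
    using S by (auto simp: polar_commute[of a])
qed

text \<open>The hypothesis \<open>basis\<close> expands every vector in a symplectic basis and
  thereby forces \<open>B\<close> to be nondegenerate. The formula for \<open>2 f\<close> comes from
  adding two expressions for \<open>f v\<close>.\<close>

lemma skew_in_of_polar:
  assumes M: "gl_lie_subalgebra M" and two: "(2::'a) \<noteq> 0"
    and basis: "\<And>v. v = (\<Sum>l\<in>I. B (a l) v *s b l - B (b l) v *s a l)"
    and polar: "\<And>y z. polar_map B y z \<in> M"
    and f: "f \<in> skew_endomorphisms B"
  shows "f \<in> M"
proof -
  have sub: "gl.subspace M"
    using M by (simp add: gl.lie_subalgebra_def)
  note endo = skew_imp_endomorphism[OF f]
  have "map_scale 2 f = (\<Sum>l\<in>I. polar_map B (a l) (f (b l)) - polar_map B (b l) (f (a l)))"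
  proof
    fix v
    \<comment> \<open>First expression: expand \<open>v\<close>, then apply
      \<open>f\<close>.\<close>
    have "f v = f (\<Sum>l\<in>I. B (a l) v *s b l - B (b l) v *s a l)"
      using basis[of v] by simp
    also have "\<dots> = (\<Sum>l\<in>I. B (a l) v *s f (b l) - B (b l) v *s f (a l))"
      using endo by (simp add: endomorphism_sum endomorphism_diff endomorphisms_iff)
    finally have 1: "f v = \<dots>" .
    \<comment> \<open>Second expression: expand \<open>f v\<close> itself, then move
      \<open>f\<close> across \<open>B\<close> in the coefficients.\<close>
    have "f v = (\<Sum>l\<in>I. B (a l) (f v) *s b l - B (b l) (f v) *s a l)"
      by (rule basis)
    also have "\<dots> = (\<Sum>l\<in>I. B (f (b l)) v *s a l - B (f (a l)) v *s b l)"
      using f by (simp add: skew_swap)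
    finally have 2: "f v = \<dots>" .
    have "map_scale 2 f v = f v + f v"
      using vec.scale_left_distrib[of 1 1 "f v"] by (simp add: map_scale_def)
    also have "\<dots> = (\<Sum>l\<in>I. B (a l) v *s f (b l) - B (b l) v *s f (a l))
        + (\<Sum>l\<in>I. B (f (b l)) v *s a l - B (f (a l)) v *s b l)"
      using 1 2 by metis
    also have "\<dots> = (\<Sum>l\<in>I. polar_map B (a l) (f (b l)) v - polar_map B (b l) (f (a l)) v)"
      by (simp add: polar_map_def algebra_simps flip: sum.distrib)
    also have "\<dots> = (\<Sum>l\<in>I. polar_map B (a l) (f (b l)) - polar_map B (b l) (f (a l))) v"
      by (induction I rule: infinite_finite_induct) auto
    finally show "map_scale 2 f v = \<dots>" .
  qed
  then have "map_scale 2 f \<in> M"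
    using sub polar by (simp add: gl.subspace_sum gl.subspace_diff)
  then have "map_scale (inverse 2) (map_scale 2 f) \<in> M"
    using sub by (rule gl.subspace_scale[rotated])
  then show ?thesis
    using two by (simp add: map_scale_def)
qed

end

section \<open>The standard symplectic form in coordinates\<close>

context
  fixes m n :: nat and p :: "nat \<Rightarrow> 'n::finite"
  assumes n: "n = 2 * m" and p: "bij_betw p {1..n} UNIV"
begin

text \<open>Split the rows into the two blocks of length \<open>m\<close>; each row of the matrix
  has a single nonzero entry, \<open>1\<close> in the upper block and \<open>-1\<close> in the lower
  one.\<close>

lemma symp_form_eq:
  "symp_form n p v w = (\<Sum>l=1..m. v $ p l * w $ p (l + m) - v $ p (l + m) * (w :: 'a::field^'n) $ p l)"
proof -
  have split: "(\<Sum>i=1..n. g i) = (\<Sum>i=1..m. g i) + (\<Sum>i=1..m. g (i + m))" for g :: "nat \<Rightarrow> 'a"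
  proof -
    have "{1..n} = {1..m} \<union> {1+m..m+m}" using n by auto
    then show ?thesis
      using sum.shift_bounds_cl_nat_ivl[of g 1 m m] by (simp add: sum.union_disjoint)
  qed
  have 1: "(\<Sum>j=1..n. v $ p i * symp_matrix n i j * w $ p j) = v $ p i * w $ p (i + m)"
    if "i \<in> {1..m}" for i
  proof -
    have "(\<Sum>j=1..n. v $ p i * symp_matrix n i j * w $ p j) =
        (\<Sum>j=1..n. if j = i + m then v $ p i * w $ p (i + m) else 0)"
      using that n by (intro sum.cong) (auto simp: symp_matrix_def)
    then show ?thesis using that n by (simp add: sum.delta)
  qed
  have 2: "(\<Sum>j=1..n. v $ p (i + m) * symp_matrix n (i + m) j * w $ p j) =
      - (v $ p (i + m) * w $ p i)" if "i \<in> {1..m}" for i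
  proof -
    have "(\<Sum>j=1..n. v $ p (i + m) * symp_matrix n (i + m) j * w $ p j) =
        (\<Sum>j=1..n. if j = i then - (v $ p (i + m) * w $ p i) else 0)"
      using that n by (intro sum.cong) (auto simp: symp_matrix_def)
    then show ?thesis using that n by (simp add: sum.delta)
  qed
  show ?thesis
    unfolding symp_form_def split[of "\<lambda>i. \<Sum>j=1..n. v $ p i * symp_matrix n i j * w $ p j"]
    by (simp only: 1 2 sum_subtractf sum_negf cong: sum.cong) simp
qed

lemma alternating_symp_form: "alternating_form (symp_form n p :: 'a::field^'n \<Rightarrow> _)"
  by unfold_locales
    (simp_all add: symp_form_eq algebra_simps sum.distrib sum_distrib_left sum_subtractf)

lemma std_basis_nth:
  "i \<in> {1..n} \<Longrightarrow> j \<in> {1..n} \<Longrightarrow> std_basis p i $ p j = (if i = j then 1 else 0)"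
  using p by (auto simp: std_basis_def axis_def bij_betw_def inj_on_eq_iff)

lemma symp_form_std_basis_left:
  fixes w :: "'a::field^'n"
  assumes "l \<in> {1..m}"
  shows "symp_form n p (std_basis p l) w = w $ p (l + m)"
    and "symp_form n p (std_basis p (l + m)) w = - (w $ p l)"
proof -
  have "symp_form n p (std_basis p l) w = (\<Sum>k=1..m. if k = l then w $ p (l + m) else 0)"
    unfolding symp_form_eq using assms n
    by (intro sum.cong) (auto simp: std_basis_nth)
  then show "symp_form n p (std_basis p l) w = w $ p (l + m)"
    using assms by (simp add: sum.delta)
  have "symp_form n p (std_basis p (l + m)) w = (\<Sum>k=1..m. if k = l then - (w $ p l) else 0)"
    unfolding symp_form_eq using assms n
    by (intro sum.cong) (auto simp: std_basis_nth)
  then show "symp_form n p (std_basis p (l + m)) w = - (w $ p l)"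
    using assms by (simp add: sum.delta)
qed

lemma symplectic_expansion:
  fixes v :: "'a::field^'n"
  shows "v = (\<Sum>l=1..m. symp_form n p (std_basis p l) v *s std_basis p (l + m)
    - symp_form n p (std_basis p (l + m)) v *s std_basis p l)"
proof -
  have *: "v $ p k = (\<Sum>l=1..m. symp_form n p (std_basis p l) v *s std_basis p (l + m)
    - symp_form n p (std_basis p (l + m)) v *s std_basis p l) $ p k" if k: "k \<in> {1..n}" for k
  proof -
    have "(\<Sum>l=1..m. symp_form n p (std_basis p l) v *s std_basis p (l + m)
        - symp_form n p (std_basis p (l + m)) v *s std_basis p l) $ p k
      = (\<Sum>l=1..m. (if l = k - m \<and> m < k then v $ p k else 0) + (if l = k then v $ p k else 0))"
      unfolding sum_component
    proof (intro sum.cong refl)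
      fix l assume l: "l \<in> {1..m}"
      then have "l \<in> {1..n}" "l + m \<in> {1..n}"
        using n by auto
      with l show "(symp_form n p (std_basis p l) v *s std_basis p (l + m)
          - symp_form n p (std_basis p (l + m)) v *s std_basis p l) $ p k
        = (if l = k - m \<and> m < k then v $ p k else 0) + (if l = k then v $ p k else 0)"
        using k by (auto simp: symp_form_std_basis_left std_basis_nth)
    qed
    also have "\<dots> = v $ p k"
      using k n by (cases "m < k") (auto simp: sum.distrib sum.delta)
    finally show ?thesis by simp
  qed
  show ?thesis
    unfolding vec_eq_iff[of v]
  proof
    fix i
    obtain k where "k \<in> {1..n}" "i = p k"
      using bij_betw_imp_surj_on[OF p] by blast
    then show "v $ i = (\<Sum>l=1..m. symp_form n p (std_basis p l) v *s std_basis p (l + m)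
        - symp_form n p (std_basis p (l + m)) v *s std_basis p l) $ i"
      by (simp only: *[symmetric])
  qed
qed

end

section \<open>Realizing the path and generating the symplectic Lie algebra\<close>

lemma two_neq_0_of_CHAR:
  assumes "CHAR('a::field) \<noteq> 2"
  shows "(2::'a) \<noteq> 0"
proof
  assume "(2::'a) = 0"
  then have "CHAR('a) dvd 2"
    using of_nat_eq_0_iff_char_dvd[of 2, where 'a='a] by simp
  then have "CHAR('a) \<le> 2" by (rule dvd_imp_le) simp
  then show False
    using assms \<open>CHAR('a) dvd 2\<close> CHAR_not_1[where 'a='a] by (cases "CHAR('a)") auto
qed

theorem theorem6p10:
  fixes n :: nat
    and p :: "nat \<Rightarrow> 'n::finite"
    and x :: "nat \<Rightarrow> 'a::alg_closed_field ^ 'n"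
  defines "e \<equiv> (std_basis p :: nat \<Rightarrow> 'a ^ 'n)"
    and "B \<equiv> (symp_form n p :: 'a ^ 'n \<Rightarrow> 'a ^ 'n \<Rightarrow> 'a)"
  assumes "n \<ge> 2" and "even n"
    and "CHAR('a) \<noteq> 2"
    and "CARD('n) = n" and "bij_betw p {1..n} UNIV"
    and "\<And>l. 1 \<le> l \<Longrightarrow> l \<le> n div 2 \<Longrightarrow> x (2 * l - 1) = e l"
    and "\<And>l. 1 \<le> l \<Longrightarrow> l < n div 2 \<Longrightarrow> x (2 * l) = e (l + n div 2) + e (l + n div 2 + 1)"
    and "x n = e n"
  shows "gl_realizes n (path_edges n) (\<lambda>i. rank_one_map B (x i))
    \<and> gl_lie_generated ((\<lambda>i. rank_one_map B (x i)) ` {1..n}) = skew_endomorphisms B"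
proof -
  obtain m where n: "n = 2 * m"
    using \<open>even n\<close> by blast
  have m: "n div 2 = m" using n by simp
  note p = \<open>bij_betw p {1..n} UNIV\<close>
  have two: "(2::'a) \<noteq> 0"
    using \<open>CHAR('a) \<noteq> 2\<close> by (rule two_neq_0_of_CHAR)
  interpret alternating_form B
    unfolding B_def by (rule alternating_symp_form[OF n p])
  have expansion: "v = (\<Sum>l=1..m. B (e l) v *s e (l + m) - B (e (l + m)) v *s e l)" for v
    unfolding B_def e_def by (rule symplectic_expansion[OF n p])
  have Be: "B (e l) (e k) = (if k = l + m then 1 else 0)"
    "B (e (l + m)) (e k) = (if k = l then - 1 else 0)" if "l \<in> {1..m}" "k \<in> {1..n}" for k l
  proof -
    have "l \<in> {1..n}" "l + m \<in> {1..n}"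
      using that n by auto
    with that show "B (e l) (e k) = (if k = l + m then 1 else 0)"
      "B (e (l + m)) (e k) = (if k = l then - 1 else 0)"
      unfolding B_def e_def
      by (simp_all add: symp_form_std_basis_left[OF n p] std_basis_nth[OF n p])
  qed
  have odd: "x (2 * l - 1) = e l" if "l \<in> {1..m}" for l
    using that assms(8)[of l, unfolded m] by simp
  \<comment> \<open>The case \<open>l = m\<close> covers the last vector \<open>x n\<close>, which
    has no second summand.\<close>
  have even: "x (2 * l) = e (l + m) + (if l = m then 0 else e (Suc l + m))" if "l \<in> {1..m}" for l
  proof (cases "l = m")
    case True
    then show ?thesis
      using \<open>x n = e n\<close> n by (simp add: mult_2)
  next
    case False
    then show ?thesis
      using that assms(9)[of l, unfolded m] by simp
  qed
  have idx: "\<exists>l\<in>{1..m}. i = 2 * l - 1 \<or> i = 2 * l" if "1 \<le> i" "i \<le> n" for i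
  proof (cases "even i")
    case True
    then obtain l where "i = 2 * l" by blast
    then show ?thesis using that n by (intro bexI[of _ l]) auto
  next
    case False
    then obtain l where "i = 2 * l + 1" by (elim oddE)
    then show ?thesis using that n by (intro bexI[of _ "Suc l"]) auto
  qed
  \<comment> \<open>The Gram matrix above the diagonal, by the parities of \<open>i\<close> and
    \<open>j\<close>. For equal parity both vectors lie in the span of one half of the basis, where
    \<open>B\<close> vanishes.\<close>
  have form: "B (x i) (x j) = (if j = Suc i then (if odd i then 1 else - 1) else 0)"
    if ij: "1 \<le> i" "i < j" "j \<le> n" for i j
  proof -
    obtain k where k: "k \<in> {1..m}" "i = 2 * k - 1 \<or> i = 2 * k"
      using idx[of i] ij by fastforce
    obtain l where l: "l \<in> {1..m}" "j = 2 * l - 1 \<or> j = 2 * l"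
      using idx[of j] ij by fastforce
    have kn: "k \<in> {1..n}" "k + m \<in> {1..n}" "k \<noteq> m \<Longrightarrow> Suc k \<in> {1..m}"
      and ln: "l \<in> {1..n}" "l + m \<in> {1..n}" "l \<noteq> m \<Longrightarrow> Suc l + m \<in> {1..n}"
      using k(1) l(1) n by auto
    have kl: "1 \<le> k" "k \<le> m" "1 \<le> l" "l \<le> m"
      using k(1) l(1) by auto
    from k(2) l(2) show ?thesis
    proof (elim disjE)
      assume *: "i = 2 * k - 1" "j = 2 * l - 1"
      have "j \<noteq> Suc i" "l \<noteq> k + m"
        using * ij(2) kl by presburger+
      moreover have "x i = e k" "x j = e l"
        unfolding * using odd k(1) l(1) by auto
      ultimately show ?thesis
        using Be(1)[OF k(1) ln(1)] by simp
    next
      assume *: "i = 2 * k - 1" "j = 2 * l"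
      \<comment> \<open>\<open>e k\<close> pairs with \<open>x (2 * l)\<close> only for
        \<open>l = k\<close> and \<open>l = k - 1\<close>; the order \<open>i < j\<close> excludes
        the latter.\<close>
      have "j = Suc i \<longleftrightarrow> l = k" "k \<le> l"
        using * ij(2) kl by presburger+
      moreover have "odd i"
        using * kl by presburger
      moreover have "x i = e k" "x j = e (l + m) + (if l = m then 0 else e (Suc l + m))"
        unfolding * using odd even k(1) l(1) by auto
      ultimately show ?thesis
        using Be(1)[OF k(1) ln(2)] Be(1)[OF k(1) ln(3)] by (auto simp: add_right zero_right)
    next
      assume *: "i = 2 * k" "j = 2 * l - 1"
      \<comment> \<open>\<open>x (2 * k)\<close> pairs only with \<open>e k\<close> and
        \<open>e (Suc k)\<close>; the order \<open>i < j\<close> excludes the former.\<close>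
      have "j = Suc i \<longleftrightarrow> l = Suc k" "k < l" "k \<noteq> m"
        using * ij(2) kl by presburger+
      moreover have "x i = e (k + m) + (if k = m then 0 else e (Suc k + m))" "x j = e l"
        unfolding * using odd even k(1) l(1) by auto
      ultimately show ?thesis
        using Be(2)[OF k(1) ln(1)] Be(2)[OF kn(3) ln(1)] * by (simp add: add_left)
    next
      assume *: "i = 2 * k" "j = 2 * l"
      have "j \<noteq> Suc i" "k \<noteq> m"
        using * ij(2) kl by presburger+
      moreover have "x i = e (k + m) + (if k = m then 0 else e (Suc k + m))"
        "x j = e (l + m) + (if l = m then 0 else e (Suc l + m))"
        unfolding * using even k(1) l(1) by auto
      ultimately show ?thesis
        using Be(2)[OF k(1) ln(2)] Be(2)[OF kn(3) ln(2)] Be(2)[OF k(1) ln(3)]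
          Be(2)[OF kn(3) ln(3)] k(1) l(1) n * ij
        by (auto simp: add_left add_right zero_right)
    qed
  qed
  have edge: "{i, j} \<in> path_edges n \<longleftrightarrow> B (x i) (x j) \<noteq> 0"
    if "i \<in> {1..n}" "j \<in> {1..n}" "i \<noteq> j" for i j
  proof -
    have "{i, j} \<in> path_edges n \<longleftrightarrow> B (x i) (x j) \<noteq> 0" if "1 \<le> i" "i < j" "j \<le> n" for i j
      using that form[OF that] by (auto simp: path_edges_def doubleton_eq_iff)
    from this[of i j] this[of j i] show ?thesis
      using that antisym[of "x i" "x j"] by (cases "i < j") (auto simp: insert_commute)
  qed
  define M where "M = gl_lie_generated ((\<lambda>i. rank_one_map B (x i)) ` {1..n})"
  have endo: "rank_one_map B z \<in> endomorphisms" for z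
    by (rule skew_imp_endomorphism[OF rank_one_skew])
  have M: "gl_lie_subalgebra M"
    unfolding M_def using endo by (intro gl.lie_subalgebra_generated) auto
  have gen: "rank_one_map B (x i) \<in> M" if "1 \<le> i" "i \<le> n" for i
    unfolding M_def using that by (intro subsetD[OF gl.lie_generated_superset]) auto
  have extremal: "gl_extremal_in M (rank_one_map B (x i))" if i: "i \<in> {1..n}" for i
  proof -
    \<comment> \<open>A neighbour on the path witnesses that the rank one map is nonzero: the
      successor of \<open>i\<close>, or \<open>n - 1\<close> when \<open>i = n\<close>, which is a
      vertex because \<open>n \<ge> 2\<close>.\<close>
    obtain j where "B (x i) (x j) \<noteq> 0"
    proof (cases "i = n")
      case True
      then show ?thesis
        using that[of "n - 1"] form[of "n - 1" n] antisym[of "x n" "x (n - 1)"] \<open>n \<ge> 2\<close>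
        by (simp split: if_splits)
    next
      case False
      then show ?thesis
        using that[of "Suc i"] form[of i "Suc i"] i by (simp split: if_splits)
    qed
    then have "rank_one_map B (x i) (x j) \<noteq> 0"
      by (auto simp: rank_one_map_def zero_left)
    then have "rank_one_map B (x i) \<noteq> 0"
      by auto
    moreover have "M \<subseteq> endomorphisms"
      using M by (simp add: gl.lie_subalgebra_def)
    moreover have "commutator (rank_one_map B (x i)) (commutator (rank_one_map B (x i)) f)
        \<in> range (\<lambda>c. map_scale c (rank_one_map B (x i)))" if "f \<in> endomorphisms" for f
      unfolding commutator_rank_one_twice[OF that] by (rule rangeI)
    ultimately show ?thesis
      unfolding gl.extremal_in_def image_subset_iff using gen[of i] i
      by (meson atLeastAtMost_iff subsetD)
  qed
  have "e l \<in> vec.span (x ` {1..n})" if "l \<in> {1..m}" for l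
    using odd[OF that] that n by (intro vec.span_base) (auto intro!: image_eqI[of _ _ "2 * l - 1"])
  moreover have "e (l + m) \<in> vec.span (x ` {1..n})" if "1 \<le> l" "l \<le> m" for l
    using \<open>l \<le> m\<close> \<open>1 \<le> l\<close>
  \<comment> \<open>Descending induction: \<open>e (m + m)\<close> is \<open>x n\<close>, and
    subtracting \<open>e (Suc l + m)\<close> from \<open>x (2 * l)\<close> leaves
    \<open>e (l + m)\<close>.\<close>
  proof (induction l rule: inc_induct)
    case base
    then show ?case
      using even[of m] n by (intro vec.span_base) (auto intro!: image_eqI[of _ _ "2 * m"])
  next
    case (step l)
    have "x (2 * l) \<in> vec.span (x ` {1..n})"
      using step n by (intro vec.span_base) auto
    from vec.span_diff[OF this step.IH] show ?case
      using even[of l] step by simp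
  qed
  ultimately have "(\<Sum>l=1..m. B (e l) v *s e (l + m) - B (e (l + m)) v *s e l)
      \<in> vec.span (x ` {1..n})" for v
    by (intro vec.span_sum vec.span_diff vec.span_scale) auto
  then have "v \<in> vec.span (x ` {1..n})" for v
    by (simp only: expansion[symmetric])
  then have span: "vec.span (x ` {1..n}) = UNIV"
    by blast
  have "polar_map B a b \<in> M" for a b
  proof (rule polar_in_of_spanning[OF M span])
    \<comment> \<open>\<open>form\<close> supplies both the adjacency and the vanishing hypotheses,
      as it covers all pairs with \<open>i < j\<close>.\<close>
    have *: "polar_map B (x i) (x j) \<in> M" if "1 \<le> i" "i \<le> j" "j \<le> n" for i j
      using that by (intro polar_in_of_path[OF M two gen]) (auto simp: form)
    fix a b
    assume "a \<in> x ` {1..n}" "b \<in> x ` {1..n}"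
    then obtain i j where "a = x i" "b = x j" "i \<in> {1..n}" "j \<in> {1..n}" by auto
    then show "polar_map B a b \<in> M"
      using *[of i j] *[of j i] polar_commute[of "x i" "x j"] by (cases "i \<le> j") auto
  qed
  then have "skew_endomorphisms B \<subseteq> M"
    using skew_in_of_polar[OF M two expansion] by blast
  moreover have "M \<subseteq> skew_endomorphisms B"
    unfolding M_def using rank_one_skew
    by (intro gl.lie_generated_minimal skew_lie_subalgebra) auto
  ultimately have "M = skew_endomorphisms B"
    by blast
  moreover have "gl_realizes n (path_edges n) (\<lambda>i. rank_one_map B (x i))"
    unfolding gl.realizes_def commutator_rank_one_eq_0_iff
    using endo extremal edge by (auto simp: M_def)
  ultimately show ?thesis
    unfolding M_def by blast
qed

end
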